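(* Let $B$ be a Banach space, $D\subseteq B$ a nonempty closed convex subset, and $T:D\to D$ a weak-contraction map, i.e. there exist constants $\delta\in(0,1)$ and $L\ge 0$ such that $\|Tx-Ty\|\le \delta\|x-y\|+L\|y-Ty\|$ for all $x,y\in D$. Assume that $T$ has a fixed point $u^\ast\in D$. Let $\varepsilon>0$ be fixed and let $\widetilde{T}:D\to D$ be an approximate operator of $T$, i.e. $\|Tx-\widetilde{T}x\|\le\varepsilon$ for all $x\in D$. Let $\{a_n^1\}_{n=0}^\infty$, $\{a_n^2\}_{n=0}^\infty$ be real sequences in $[0,1]$ satisfying (i) $\frac12\le a_n^1a_n^2$ for all $n\in\mathbb{N}$, and (ii) $\sum_{n=0}^\infty a_n^1a_n^2=\infty$. Let $\{x_n\}_{n=0}^\infty$ be the Picard-S iterative sequence of $T$ with these parameters and initial point $x_0\in D$, and let $\{\widetilde{x}_n\}_{n=0}^\infty$ be the Picard-S iterative sequence of $\widetilde{T}$ with the same parameters and initial point $\widetilde{x}_0\in D$. If $\widetilde{u}^\ast\in D$ satisfies $\widetilde{T}\widetilde{u}^\ast=\widetilde{u}^\ast$ and $\widetilde{x}_n\to\widetilde{u}^\ast$ as $n\to\infty$, then $$\|u^\ast-\widetilde{u}^\ast\|\le\frac{5\varepsilon}{1-\delta}.$$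
   Context: $\mathbb{N}$ denotes the set of nonnegative integers. For a self-map $S:D\to D$, the Picard-S iterative sequence of $S$ with parameters $\{a_n^1\},\{a_n^2\}\subset[0,1]$ and initial point $x_0\in D$ is defined, for $n\in\mathbb{N}$, by $$z_n=(1-a_n^2)x_n+a_n^2Sx_n,\qquad y_n=(1-a_n^1)Sx_n+a_n^1Sz_n,\qquad x_{n+1}=Sy_n.$$ *)

theory Defs
  imports "HOL-Analysis.Analysis"
begin

text \<open>
  Self-maps of a set \<open>D\<close> are total functions on the ambient type together with the
  hypothesis \<open>S \<in> D \<rightarrow> D\<close>, which is stated separately from the properties below;
  values outside \<open>D\<close> are irrelevant.
\<close>

definition weak_contraction_on ::
  "'a::real_normed_vector set \<Rightarrow> real \<Rightarrow> real \<Rightarrow> ('a \<Rightarrow> 'a) \<Rightarrow> bool" where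
  "weak_contraction_on D \<delta> L T \<longleftrightarrow>
     0 < \<delta> \<and> \<delta> < 1 \<and> 0 \<le> L \<and>
     (\<forall>x\<in>D. \<forall>y\<in>D. norm (T x - T y) \<le> \<delta> * norm (x - y) + L * norm (y - T y))"

definition approximate_operator_on ::
  "'a::real_normed_vector set \<Rightarrow> real \<Rightarrow> ('a \<Rightarrow> 'a) \<Rightarrow> ('a \<Rightarrow> 'a) \<Rightarrow> bool" where
  "approximate_operator_on D \<epsilon> T T' \<longleftrightarrow> (\<forall>x\<in>D. norm (T x - T' x) \<le> \<epsilon>)"

primrec picard_S ::
  "('a::real_vector \<Rightarrow> 'a) \<Rightarrow> (nat \<Rightarrow> real) \<Rightarrow> (nat \<Rightarrow> real) \<Rightarrow> 'a \<Rightarrow> nat \<Rightarrow> 'a" where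
  "picard_S S a1 a2 x0 0 = x0"
| "picard_S S a1 a2 x0 (Suc n) =
     (let x = picard_S S a1 a2 x0 n;
          z = (1 - a2 n) *\<^sub>R x + a2 n *\<^sub>R S x;
          y = (1 - a1 n) *\<^sub>R S x + a1 n *\<^sub>R S z
      in S y)"

end

(* Applying the weak-contraction inequality at the pair (u', u), whose second entry is fixed by T,
   makes the L-term vanish, so T contracts towards u. Hence
   norm (u - u') <= norm (T u - T u') + norm (T u' - T' u') <= delta * norm (u - u') + epsilon,
   that is, norm (u - u') <= epsilon / (1 - delta). *)
theory Submission
  imports Defs
begin

lemma weak_contraction_on_fixed_point_dist_le:
  assumes "weak_contraction_on D \<delta> L T" "approximate_operator_on D \<epsilon> T T'"
    and "u \<in> D" "T u = u" "u' \<in> D" "T' u' = u'"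
  shows "norm (u - u') \<le> \<epsilon> / (1 - \<delta>)"
proof -
  have "\<delta> < 1" and "norm (T u' - T u) \<le> \<delta> * norm (u' - u) + L * norm (u - T u)"
    using assms(1,3,5) unfolding weak_contraction_on_def by blast+
  moreover have "norm (T u' - T' u') \<le> \<epsilon>"
    using assms by (auto simp: approximate_operator_on_def)
  \<comment> \<open>The detour goes through \<open>T u'\<close>: it cancels in
    \<open>(T u' - T' u') - (T u' - T u)\<close>, leaving \<open>T u - T' u'\<close>, which is
    \<open>u - u'\<close> because both points are fixed.\<close>
  moreover have "norm (u - u') \<le> norm (T u' - T u) + norm (T u' - T' u')"
    using norm_triangle_ineq4[of "T u' - T' u'" "T u' - T u"] assms(4,6) by simp
  \<comment> \<open>With \<open>T u = u\<close> the factor of \<open>L\<close> is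
    \<open>norm 0\<close>; the \<delta>-term then moves to the left, and symmetry of the norm
    matches \<open>u' - u\<close> with \<open>u - u'\<close>.\<close>
  ultimately have "norm (u - u') * (1 - \<delta>) \<le> \<epsilon>"
    using assms(4) by (simp add: norm_minus_commute algebra_simps)
  with \<open>\<delta> < 1\<close> show ?thesis
    by (simp add: pos_le_divide_eq)
qed

theorem theorem4:
  fixes D :: "'a::banach set"
    and T T' :: "'a \<Rightarrow> 'a"
    and \<delta> L \<epsilon> :: real
    and a1 a2 :: "nat \<Rightarrow> real"
    and x x' :: "nat \<Rightarrow> 'a"
    and x0 x0' u u' :: 'a
  assumes "D \<noteq> {}" and "closed D" and "convex D"
    and "T \<in> D \<rightarrow> D" and "weak_contraction_on D \<delta> L T"
    and "u \<in> D" and "T u = u"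
    and "\<epsilon> > 0"
    and "T' \<in> D \<rightarrow> D" and "approximate_operator_on D \<epsilon> T T'"
    and "\<And>n. a1 n \<in> {0..1}" and "\<And>n. a2 n \<in> {0..1}"
    and "\<And>n. 1 / 2 \<le> a1 n * a2 n"
    and "filterlim (\<lambda>N. \<Sum>n<N. a1 n * a2 n) at_top sequentially"
    and "x0 \<in> D" and "x = picard_S T a1 a2 x0"
    and "x0' \<in> D" and "x' = picard_S T' a1 a2 x0'"
    and "u' \<in> D" and "T' u' = u'"
    and "x' \<longlonglongrightarrow> u'"
  shows "norm (u - u') \<le> 5 * \<epsilon> / (1 - \<delta>)"
proof -
  have "\<delta> < 1"
    using assms(5) by (simp add: weak_contraction_on_def)
  have "norm (u - u') \<le> \<epsilon> / (1 - \<delta>)"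
    using weak_contraction_on_fixed_point_dist_le assms(5,10,6,7,19,20) by metis
  \<comment> \<open>The factor 5 is slack: \<epsilon> \<le> 5 * \<epsilon> as \<epsilon> is
    positive, and dividing by 1 - \<delta> > 0 keeps the order.\<close>
  also have "\<dots> \<le> 5 * \<epsilon> / (1 - \<delta>)"
    using \<open>\<delta> < 1\<close> \<open>\<epsilon> > 0\<close> by (intro divide_right_mono) auto
  finally show ?thesis .
qed

end
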